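(* Let $m>l\geq 2$ be integers and let $G$ be a $2K_{m-1}$-good graph with $n\geq 3$ vertices. If there exist two vertices $u$ and $v$ of degree one in $G$ such that $G-\{u,v\}$ is $K_m$-good, then $G$ is $(K_m\cup K_l)$-good.
   Context: All graphs are finite, undirected and simple. $v(G)$ is the number of vertices of $G$; $\chi(G)$ is the chromatic number; the chromatic surplus $s(G)$ is the minimum, over all proper colorings of $V(G)$ with $\chi(G)$ colors, of the number of vertices in a smallest color class. $K_m$ is the complete graph on $m$ vertices, $2K_{m-1}$ the disjoint union of two copies of $K_{m-1}$, and $K_m\cup K_l$ the disjoint union of $K_m$ and $K_l$. $G-U$ is the graph obtained from $G$ by deleting the vertices in $U$ and all edges incident to them. For graphs $G,H$, the Ramsey number $R(G,H)$ is the minimum integer $N$ such that any coloring of the edges of $K_N$ in red or blue yields a red copy of $G$ or a blue copy of $H$ (as a not necessarily induced subgraph). A connected graph $G$ with $v(G)\geq s(H)$ is called $H$-good if $R(G,H)=(v(G)-1)(\chi(H)-1)+s(H)$; "$H$-good" always includes the requirements that $G$ is connected and $v(G)\ge s(H)$. *)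

theory Defs
  imports "Graph_Theory.Graph_Theory" "HOL-Library.FuncSet"
begin

text \<open>
  A finite simple undirected graph is a \<^locale>\<open>graph\<close> of the session Graph_Theory, i.e. a
  finite symmetric digraph without loops and parallel arcs. Every undirected edge is thus a pair of
  opposite arcs; \<^const>\<open>out_degree\<close> is the degree of a vertex, \<open>G \<restriction> (verts G - U)\<close> is the
  graph \<open>G - U\<close>, and \<^const>\<open>Digraph_Component.connected\<close> is ordinary connectedness
  (of a graph with at least one vertex).
\<close>

definition complete_graph :: "nat \<Rightarrow> (nat, nat \<times> nat) pre_digraph" where
  "complete_graph n =
     with_proj \<lparr> pverts = {..<n}, parcs = {(u, v). u < n \<and> v < n \<and> u \<noteq> v} \<rparr>"

definition disjoint_union ::
  "('a, 'b) pre_digraph \<Rightarrow> ('c, 'd) pre_digraph \<Rightarrow> ('a + 'c, 'b + 'd) pre_digraph" where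
  "disjoint_union G H =
     \<lparr> verts = verts G <+> verts H, arcs = arcs G <+> arcs H,
       tail = map_sum (tail G) (tail H), head = map_sum (head G) (head H) \<rparr>"

definition proper_coloring :: "('a, 'b) pre_digraph \<Rightarrow> nat \<Rightarrow> ('a \<Rightarrow> nat) \<Rightarrow> bool" where
  "proper_coloring G k c \<longleftrightarrow>
     c \<in> verts G \<rightarrow> {..<k} \<and> (\<forall>(u, v) \<in> arcs_ends G. c u \<noteq> c v)"

definition chromatic_number :: "('a, 'b) pre_digraph \<Rightarrow> nat" where
  "chromatic_number G = (LEAST k. \<exists>c. proper_coloring G k c)"

text \<open>
  A proper coloring with \<^term>\<open>chromatic_number G\<close> colors uses every color, so no color class
  below is empty. The \<^const>\<open>Min\<close> is meaningful only if \<open>G\<close> has a vertex.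
\<close>

definition chromatic_surplus :: "('a, 'b) pre_digraph \<Rightarrow> nat" where
  "chromatic_surplus G =
     (LEAST s. \<exists>c. proper_coloring G (chromatic_number G) c \<and>
        s = Min ((\<lambda>i. card {v \<in> verts G. c v = i}) ` {..<chromatic_number G}))"

definition has_copy :: "('a, 'b) pre_digraph \<Rightarrow> ('c, 'd) pre_digraph \<Rightarrow> bool" where
  "has_copy F G \<longleftrightarrow> (\<exists>G'. subgraph G' F \<and> digraph_iso G G')"

datatype color = Red | Blue

text \<open>
  An edge coloring of \<open>complete_graph N\<close> is given by its values on the two-element sets \<open>{u, v}\<close>;
  other sets play no role.
\<close>

definition color_graph :: "nat \<Rightarrow> (nat set \<Rightarrow> color) \<Rightarrow> color \<Rightarrow> (nat, nat \<times> nat) pre_digraph" where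
  "color_graph N c x =
     with_proj \<lparr> pverts = verts (complete_graph N),
                 parcs = {(u, v) \<in> arcs (complete_graph N). c {u, v} = x} \<rparr>"

definition ramsey_number :: "('a, 'b) pre_digraph \<Rightarrow> ('c, 'd) pre_digraph \<Rightarrow> nat" where
  "ramsey_number G H =
     (LEAST N. \<forall>c. has_copy (color_graph N c Red) G \<or> has_copy (color_graph N c Blue) H)"

text \<open>
  \<open>good H G\<close> says that \<open>G\<close> is \<open>H\<close>-good. The truncated subtractions are harmless: a connected graph
  has a vertex, and \<open>chromatic_number H \<ge> 1\<close> whenever \<open>H\<close> has one.
\<close>

definition good :: "('c, 'd) pre_digraph \<Rightarrow> ('a, 'b) pre_digraph \<Rightarrow> bool" where
  "good H G \<longleftrightarrow>
     Digraph_Component.connected G \<and> card (verts G) \<ge> chromatic_surplus H \<and>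
     ramsey_number G H =
       (card (verts G) - 1) * (chromatic_number H - 1) + chromatic_surplus H"

lemma complete_digraph_complete_graph: "complete_digraph n (complete_graph n)"
  unfolding complete_graph_def complete_digraph_pair_def by auto

lemma graph_complete_graph: "graph (complete_graph n)"
  using complete_digraph_complete_graph unfolding complete_digraph_def by blast

lemma arcs_ends_disjoint_union:
  "arcs_ends (disjoint_union G H) =
     map_prod Inl Inl ` arcs_ends G \<union> map_prod Inr Inr ` arcs_ends H"
  unfolding disjoint_union_def arcs_ends_conv
  by (auto simp: Plus_def image_Un image_image)

lemma graph_disjoint_union:
  assumes "graph G" "graph H"
  shows "graph (disjoint_union G H)"
proof -
  interpret G: graph G by fact
  interpret H: graph H by fact
  have "symmetric (disjoint_union G H)"
    unfolding symmetric_def arcs_ends_disjoint_union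
    using G.sym_arcs H.sym_arcs by (auto simp: symmetric_def intro!: symI dest: symD)
  then show ?thesis
    by unfold_locales
      (auto simp: disjoint_union_def arc_to_ends_def
         intro: G.no_multi_arcs H.no_multi_arcs dest: G.no_loops H.no_loops)
qed

text \<open>For the host graphs used here, a copy is the same as an injective homomorphism.\<close>

lemma has_copy_with_proj_iff:
  assumes "graph G" and F: "pair_wf_digraph F"
  shows "has_copy (with_proj F) G \<longleftrightarrow>
    (\<exists>f. inj_on f (verts G) \<and> f ` verts G \<subseteq> pverts F \<and>
         (\<forall>(u, v) \<in> arcs_ends G. (f u, f v) \<in> parcs F))" (is "?L \<longleftrightarrow> ?R")
proof -
  interpret G: graph G by fact
  interpret F: pair_wf_digraph F by fact
  show ?thesis
  proof
    assume ?L
    then obtain h where sub: "subgraph (app_iso h G) (with_proj F)" and h: "G.digraph_isomorphism h"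
      unfolding has_copy_def digraph_iso_def by auto
    from sub have ht: "iso_tail h = fst" "iso_head h = snd"
      by (auto simp: subgraph_def compatible_def)
    show ?R
    proof (intro exI conjI)
      show "inj_on (iso_verts h) (verts G)" using h by (simp add: G.digraph_isomorphism_def)
      show "iso_verts h ` verts G \<subseteq> pverts F" using sub by (auto simp: subgraph_def)
      show "\<forall>(u, v) \<in> arcs_ends G. (iso_verts h u, iso_verts h v) \<in> parcs F"
      proof safe
        fix u v assume "(u, v) \<in> arcs_ends G"
        then obtain a where a: "a \<in> arcs G" "u = tail G a" "v = head G a"
          by (auto simp: arcs_ends_conv)
        then have "iso_arcs h a = (iso_verts h u, iso_verts h v)"
          using h ht by (auto simp: G.digraph_isomorphism_def prod_eq_iff)
        moreover have "iso_arcs h a \<in> parcs F" using sub a by (auto simp: subgraph_def)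
        ultimately show "(iso_verts h u, iso_verts h v) \<in> parcs F" by simp
      qed
    qed
  next
    assume ?R
    then obtain f where f: "inj_on f (verts G)" "f ` verts G \<subseteq> pverts F"
      "\<forall>(u, v) \<in> arcs_ends G. (f u, f v) \<in> parcs F" by blast
    define h where "h = \<lparr> iso_verts = f, iso_arcs = (\<lambda>a. (f (tail G a), f (head G a))),
      iso_head = snd, iso_tail = fst \<rparr>"
    have "inj_on (iso_arcs h) (arcs G)"
      using f(1) by (intro inj_onI G.no_multi_arcs) (auto simp: h_def arc_to_ends_def dest: inj_onD)
    then have h: "G.digraph_isomorphism h"
      using f(1) by (simp add: G.digraph_isomorphism_def h_def G.wf_digraph)
    have "subgraph (app_iso h G) (with_proj F)"
      using f(2,3) G.wf_digraphI_app_iso[OF h] F.wf_digraph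
      by (auto simp: subgraph_def compatible_def h_def arcs_ends_conv)
    with h show ?L unfolding has_copy_def digraph_iso_def by blast
  qed
qed

end

theory Submission
  imports Defs "HOL-Library.Ramsey"
begin

text \<open>
  Write \<open>H = K\<^sub>m \<union> K\<^sub>l\<close>. Since \<open>l < m\<close>, coloring both cliques from the same \<open>m\<close> colors shows
  that \<open>H\<close> has chromatic number \<open>m\<close>, and some color misses \<open>K\<^sub>l\<close>, so the surplus is \<open>1\<close>. What has
  to be proved is therefore that the Ramsey number of \<open>G\<close> and \<open>H\<close> is \<open>N = (n - 1)(m - 1) + 1\<close>.

  For the lower bound, split \<open>(n - 1)(m - 1)\<close> vertices into \<open>m - 1\<close> blocks of size \<open>n - 1\<close> and color
  an edge red iff it stays inside a block. The connected graph \<open>G\<close> is too large for a block, and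
  blue cliques have at most one vertex in each block (\<open>block_coloring\<close>).

  For the upper bound, suppose that a coloring on \<open>N\<close> vertices has no red \<open>G\<close> and no blue \<open>H\<close>.
  As \<open>N \<ge> (n - 1)(m - 2) + 2\<close>, goodness of \<open>G\<close> for \<open>2K\<^sub>m\<^sub>-\<^sub>1\<close> yields two disjoint blue cliques \<open>A\<close>
  and \<open>B\<close> of size \<open>m - 1 \<ge> l\<close>. Without them there remain \<open>(n - 3)(m - 1) + 1\<close> vertices, which is
  exactly the Ramsey number of \<open>G - {u, v}\<close> and \<open>K\<^sub>m\<close>. A blue \<open>K\<^sub>m\<close> there would form a blue \<open>H\<close>
  together with \<open>A\<close>, so there is a red copy of \<open>G - {u, v}\<close>. Each vertex \<open>x\<close> of this copy has a red
  neighbor in \<open>A\<close>, since otherwise \<open>A\<close> with \<open>x\<close> would be a blue \<open>K\<^sub>m\<close> disjoint from \<open>B\<close>; likewise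
  \<open>x\<close> has a red neighbor in \<open>B\<close>. Hence the leaf \<open>u\<close> can be attached inside \<open>A\<close> and the leaf \<open>v\<close>
  inside \<open>B\<close>, even when both hang on the same vertex, and a red \<open>G\<close> arises
  (\<open>mono_copy_add_two_leaves\<close>).
\<close>

section \<open>Monochromatic copies and Ramsey numbers\<close>

text \<open>
  Unlike \<^const>\<open>has_copy\<close>, this notion allows the host to be any vertex set \<open>S\<close>, so copies can be
  sought among the vertices left over after others have been removed.
\<close>

definition mono_copy ::
  "(nat set \<Rightarrow> color) \<Rightarrow> color \<Rightarrow> nat set \<Rightarrow> ('a, 'b) pre_digraph \<Rightarrow> ('a \<Rightarrow> nat) \<Rightarrow> bool" where
  "mono_copy c x S G f \<longleftrightarrow>
     inj_on f (verts G) \<and> f ` verts G \<subseteq> S \<and> (\<forall>(u, v) \<in> arcs_ends G. c {f u, f v} = x)"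

definition mono_clique :: "(nat set \<Rightarrow> color) \<Rightarrow> color \<Rightarrow> nat set \<Rightarrow> bool" where
  "mono_clique c x A \<longleftrightarrow> (\<forall>a \<in> A. \<forall>b \<in> A. a \<noteq> b \<longrightarrow> c {a, b} = x)"

lemma adjacent_in_graph:
  assumes "graph G" "(u, v) \<in> arcs_ends G"
  shows "u \<in> verts G" "v \<in> verts G" "u \<noteq> v" "(v, u) \<in> arcs_ends G"
proof -
  interpret graph G by fact
  show "u \<in> verts G" "v \<in> verts G" using assms(2) by (auto dest: adj_in_verts)
  show "u \<noteq> v" using assms(2) adj_not_same by blast
  show "(v, u) \<in> arcs_ends G" using assms(2) sym_arcs by (auto simp: symmetric_def dest: symD)
qed

lemma has_copy_color_graph_iff:
  assumes "graph G"
  shows "has_copy (color_graph N c x) G \<longleftrightarrow> (\<exists>f. mono_copy c x {..<N} G f)"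
proof -
  define F where "F = \<lparr> pverts = {..<N}, parcs = {(u, v) \<in> arcs (complete_graph N). c {u, v} = x} \<rparr>"
  have F: "color_graph N c x = with_proj F"
    by (simp add: color_graph_def F_def complete_graph_def)
  have "pair_wf_digraph F"
    by unfold_locales (auto simp: F_def complete_graph_def)
  note iff = has_copy_with_proj_iff[OF assms this, folded F]
  have "(inj_on f (verts G) \<and> f ` verts G \<subseteq> pverts F \<and> (\<forall>(u, v) \<in> arcs_ends G. (f u, f v) \<in> parcs F))
     \<longleftrightarrow> mono_copy c x {..<N} G f" for f
  proof -
    have "(f u, f v) \<in> parcs F \<longleftrightarrow> c {f u, f v} = x"
      if "inj_on f (verts G)" "f ` verts G \<subseteq> {..<N}" "(u, v) \<in> arcs_ends G" for u v
    proof -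
      have "f u < N" "f v < N" "f u \<noteq> f v"
        using that adjacent_in_graph[OF assms that(3)] by (auto simp: inj_on_eq_iff)
      then show ?thesis by (simp add: F_def complete_graph_def)
    qed
    moreover have "pverts F = {..<N}" by (simp add: F_def)
    ultimately show ?thesis unfolding mono_copy_def by (smt (verit) case_prodD case_prodI2)
  qed
  then show ?thesis unfolding iff by simp
qed

lemma mono_copy_mono:
  "mono_copy c x S G f \<Longrightarrow> S \<subseteq> T \<Longrightarrow> mono_copy c x T G f"
  by (auto simp: mono_copy_def)

text \<open>
  If \<open>g\<close> names elements of \<open>T\<close> by elements of \<open>S\<close>, then a copy found among the names, with the
  coloring that \<open>g\<close> induces on them, becomes a copy in \<open>T\<close>.
\<close>

lemma mono_copy_pullback:
  assumes "mono_copy (\<lambda>e. c (g ` e)) x S G f" "inj_on g S" "g ` S \<subseteq> T"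
  shows "mono_copy c x T G (g \<circ> f)"
proof -
  have f: "inj_on f (verts G)" "f ` verts G \<subseteq> S" "\<forall>(u, v) \<in> arcs_ends G. c (g ` {f u, f v}) = x"
    using assms(1) by (auto simp: mono_copy_def)
  have "inj_on (g \<circ> f) (verts G)" using f(1,2) assms(2) by (blast intro: comp_inj_on inj_on_subset)
  moreover have "(g \<circ> f) ` verts G \<subseteq> T" using f(2) assms(3) by auto
  ultimately show ?thesis using f(3) by (simp add: mono_copy_def)
qed

lemma mono_copy_in_clique:
  assumes "graph G" "mono_clique c x A" "card A = card (verts G)" "finite A"
  shows "\<exists>f. mono_copy c x A G f"
proof -
  interpret graph G by fact
  obtain f where f: "bij_betw f (verts G) A"
    using finite_same_card_bij[of "verts G" A] assms by auto
  have "mono_copy c x A G f"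
    unfolding mono_copy_def
  proof (intro conjI ballI)
    show "inj_on f (verts G)" "f ` verts G \<subseteq> A" using f by (auto simp: bij_betw_def)
    fix e assume e: "e \<in> arcs_ends G"
    obtain u v where uv: "e = (u, v)" by force
    note * = adjacent_in_graph[OF assms(1), of u v]
    have "f u \<in> A" "f v \<in> A" "f u \<noteq> f v"
      using * e uv f by (auto simp: bij_betw_def dest: inj_onD)
    then show "case e of (u, v) \<Rightarrow> c {f u, f v} = x" using assms(2) uv by (auto simp: mono_clique_def)
  qed
  then show ?thesis by blast
qed

text \<open>
  By Ramsey's theorem a large host has a monochromatic clique, and a clique contains every graph on
  as many vertices. Only because such a number exists does the \<^const>\<open>Least\<close> in
  \<^const>\<open>ramsey_number\<close> have the property it is chosen for, so that a goodness hypothesis says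
  something about colorings.
\<close>

lemma ramsey_property_exists:
  assumes "graph G" "graph H"
  shows "\<exists>N. \<forall>c. has_copy (color_graph N c Red) G \<or> has_copy (color_graph N c Blue) H"
proof -
  obtain N :: nat where "\<forall>(V :: nat set) E. finite V \<and> card V \<ge> N \<longrightarrow>
      (\<exists>R \<subseteq> V. card R = card (verts G) \<and> clique R E \<or> card R = card (verts H) \<and> indep R E)"
    using ramsey2[of "card (verts G)" "card (verts H)"] by auto
  then have N: "\<And>(V :: nat set) E. finite V \<Longrightarrow> card V \<ge> N \<Longrightarrow>
      \<exists>R \<subseteq> V. card R = card (verts G) \<and> clique R E \<or> card R = card (verts H) \<and> indep R E"
    by simp
  have "has_copy (color_graph N c Red) G \<or> has_copy (color_graph N c Blue) H" for c
  proof -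
    have not_red: "c e \<noteq> Red \<longleftrightarrow> c e = Blue" for e by (cases "c e") auto
    obtain R where R: "R \<subseteq> {..<N}" and
      "card R = card (verts G) \<and> clique R {e. c e = Red} \<or> card R = card (verts H) \<and> indep R {e. c e = Red}"
      using N[of "{..<N}" "{e. c e = Red}"] by auto
    then consider "card R = card (verts G)" "mono_clique c Red R"
      | "card R = card (verts H)" "mono_clique c Blue R"
      using not_red by (auto simp: clique_def indep_def mono_clique_def)
    then show ?thesis
    proof cases
      case 1
      then show ?thesis
        using mono_copy_in_clique[OF assms(1) 1(2,1)] finite_subset[OF R] mono_copy_mono[OF _ R]
        unfolding has_copy_color_graph_iff[OF assms(1)] by blast
    next
      case 2
      then show ?thesis
        using mono_copy_in_clique[OF assms(2) 2(2,1)] finite_subset[OF R] mono_copy_mono[OF _ R]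
        unfolding has_copy_color_graph_iff[OF assms(2)] by blast
    qed
  qed
  then show ?thesis by blast
qed

text \<open>
  This is how a known Ramsey number is applied to a set of vertices that need not be an initial
  segment: name \<^term>\<open>ramsey_number G H\<close> many elements of \<open>S\<close> injectively and pull the coloring
  back.
\<close>

lemma ramsey_number_mono_copy:
  assumes G: "graph G" and H: "graph H" and S: "finite S" "card S \<ge> ramsey_number G H"
  obtains f where "mono_copy c Red S G f" | f where "mono_copy c Blue S H f"
proof -
  define R where "R = ramsey_number G H"
  have R: "has_copy (color_graph R c Red) G \<or> has_copy (color_graph R c Blue) H" for c
    using LeastI_ex[OF ramsey_property_exists[OF G H]] unfolding R_def ramsey_number_def by blast
  obtain g where g: "inj_on g {..<R}" "g ` {..<R} \<subseteq> S"
    using card_le_inj[of "{..<R}" S] S by (auto simp: R_def)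
  have "(\<exists>f. mono_copy c Red S G f) \<or> (\<exists>f. mono_copy c Blue S H f)"
    using R[of "\<lambda>e. c (g ` e)"] unfolding has_copy_color_graph_iff[OF G] has_copy_color_graph_iff[OF H]
    by (auto dest: mono_copy_pullback[OF _ g])
  then show ?thesis using that by blast
qed

section \<open>Disjoint unions of complete graphs\<close>

lemma verts_complete_graph [simp]: "verts (complete_graph k) = {..<k}"
  and arcs_ends_complete_graph [simp]:
    "arcs_ends (complete_graph k) = {(u, v). u < k \<and> v < k \<and> u \<noteq> v}"
  by (auto simp: complete_graph_def arcs_ends_conv)

lemma verts_disjoint_union [simp]: "verts (disjoint_union G H) = verts G <+> verts H"
  by (simp add: disjoint_union_def)

lemma mono_copy_disjoint_union_iff:
  "mono_copy c x S (disjoint_union G H) f \<longleftrightarrow>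
     mono_copy c x S G (f \<circ> Inl) \<and> mono_copy c x S H (f \<circ> Inr) \<and>
     f ` Inl ` verts G \<inter> f ` Inr ` verts H = {}"
proof -
  have "Inl ` verts G - Inr ` verts H = Inl ` verts G" "Inr ` verts H - Inl ` verts G = Inr ` verts H"
    by blast+
  then have "inj_on f (verts (disjoint_union G H)) \<longleftrightarrow>
      inj_on (f \<circ> Inl) (verts G) \<and> inj_on (f \<circ> Inr) (verts H) \<and>
      f ` Inl ` verts G \<inter> f ` Inr ` verts H = {}"
    unfolding verts_disjoint_union Plus_def inj_on_Un
    using comp_inj_on_iff[of Inl "verts G" f] comp_inj_on_iff[of Inr "verts H" f] by simp
  moreover have "f ` verts (disjoint_union G H) \<subseteq> S \<longleftrightarrow>
      (f \<circ> Inl) ` verts G \<subseteq> S \<and> (f \<circ> Inr) ` verts H \<subseteq> S"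
    by (simp add: Plus_def image_Un image_comp)
  moreover have "(\<forall>(u, v) \<in> arcs_ends (disjoint_union G H). c {f u, f v} = x) \<longleftrightarrow>
      (\<forall>(u, v) \<in> arcs_ends G. c {(f \<circ> Inl) u, (f \<circ> Inl) v} = x) \<and>
      (\<forall>(u, v) \<in> arcs_ends H. c {(f \<circ> Inr) u, (f \<circ> Inr) v} = x)"
    unfolding arcs_ends_disjoint_union ball_Un by (simp add: case_prod_beta)
  ultimately show ?thesis unfolding mono_copy_def by argo
qed

lemma mono_copy_complete_graphD:
  assumes "mono_copy c x S (complete_graph k) f"
  shows "mono_clique c x (f ` {..<k})" "card (f ` {..<k}) = k" "f ` {..<k} \<subseteq> S"
proof -
  have f: "inj_on f {..<k}" "f ` {..<k} \<subseteq> S"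
    "\<And>u v. u < k \<Longrightarrow> v < k \<Longrightarrow> u \<noteq> v \<Longrightarrow> c {f u, f v} = x"
    using assms by (auto simp: mono_copy_def)
  show "f ` {..<k} \<subseteq> S" by (fact f(2))
  show "card (f ` {..<k}) = k" using f(1) by (simp add: card_image)
  have "c {f u, f v} = x" if "u < k" "v < k" "f u \<noteq> f v" for u v
    using f(3)[of u v] that by metis
  then show "mono_clique c x (f ` {..<k})" by (simp add: mono_clique_def)
qed

lemma mono_copy_complete_unionI:
  assumes "mono_clique c x A" "mono_clique c x B" "card A = p" "card B \<ge> q" "A \<inter> B = {}"
    "finite A" "finite B"  "A \<union> B \<subseteq> S"
  shows "\<exists>f. mono_copy c x S (disjoint_union (complete_graph p) (complete_graph q)) f"
proof -
  obtain B' where B': "B' \<subseteq> B" "card B' = q" using obtain_subset_with_card_n[OF assms(4)] by blast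
  have "mono_clique c x B'" "finite B'"
    using assms(2,7) B'(1) finite_subset unfolding mono_clique_def by blast+
  then obtain f g where "mono_copy c x A (complete_graph p) f" "mono_copy c x B' (complete_graph q) g"
    using mono_copy_in_clique[OF graph_complete_graph, of c x A p]
      mono_copy_in_clique[OF graph_complete_graph, of c x B' q] assms B' by auto
  moreover from this have "f ` {..<p} \<inter> g ` {..<q} = {}"
    using assms(5) B'(1) by (fastforce simp: mono_copy_def)
  moreover have "A \<subseteq> S" "B' \<subseteq> S" using assms(8) B'(1) by auto
  ultimately have "mono_copy c x S (disjoint_union (complete_graph p) (complete_graph q)) (case_sum f g)"
    unfolding mono_copy_disjoint_union_iff by (auto simp: image_comp o_def intro: mono_copy_mono)
  then show ?thesis by blast
qed

section \<open>Chromatic number and chromatic surplus\<close>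

lemma proper_coloring_complete_graph_iff:
  "proper_coloring (complete_graph p) k c \<longleftrightarrow> inj_on c {..<p} \<and> c ` {..<p} \<subseteq> {..<k}"
  by (auto simp: proper_coloring_def inj_on_def)

lemma proper_coloring_disjoint_union_iff:
  "proper_coloring (disjoint_union G H) k c \<longleftrightarrow>
     proper_coloring G k (c \<circ> Inl) \<and> proper_coloring H k (c \<circ> Inr)"
  unfolding proper_coloring_def arcs_ends_disjoint_union ball_Un
  by (auto simp: case_prod_beta Pi_def)

lemma proper_coloring_complete_graph_le:
  "proper_coloring (complete_graph p) k c \<Longrightarrow> p \<le> k"
  unfolding proper_coloring_complete_graph_iff using card_inj_on_le[of c "{..<p}" "{..<k}"] by simp

lemma chromatic_number_complete_graph: "chromatic_number (complete_graph p) = p"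
  unfolding chromatic_number_def
  by (rule Least_equality)
    (auto intro: proper_coloring_complete_graph_le simp: proper_coloring_complete_graph_iff
       intro!: exI[of _ id])

lemma chromatic_number_complete_union:
  assumes "q \<le> p"
  shows "chromatic_number (disjoint_union (complete_graph p) (complete_graph q)) = p"
  unfolding chromatic_number_def
proof (rule Least_equality)
  show "\<exists>c. proper_coloring (disjoint_union (complete_graph p) (complete_graph q)) p c"
    using assms by (intro exI[of _ "case_sum id id"])
      (auto simp: proper_coloring_disjoint_union_iff proper_coloring_complete_graph_iff o_def)
qed (auto intro: proper_coloring_complete_graph_le simp: proper_coloring_disjoint_union_iff)

text \<open>
  The outer minimum is over equal values when all optimal colorings have a smallest class of the
  same size, which is the case for a complete graph and for a union of two complete graphs.
\<close>

lemma chromatic_surplus_eqI: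
  assumes "\<exists>c. proper_coloring G (chromatic_number G) c"
    and "\<And>c. proper_coloring G (chromatic_number G) c \<Longrightarrow>
       Min ((\<lambda>i. card {v \<in> verts G. c v = i}) ` {..<chromatic_number G}) = s"
  shows "chromatic_surplus G = s"
proof -
  obtain c where "proper_coloring G (chromatic_number G) c" using assms(1) by blast
  moreover from this have "Min ((\<lambda>i. card {v \<in> verts G. c v = i}) ` {..<chromatic_number G}) = s"
    by (rule assms(2))
  ultimately show ?thesis
    unfolding chromatic_surplus_def by (intro Least_equality) (auto simp: assms(2) intro!: exI[of _ c])
qed

lemma color_class_complete_graph:
  assumes "inj_on c {..<p}"
  shows "card {v \<in> {..<p}. c v = i} = (if i \<in> c ` {..<p} then 1 else 0)"
proof (cases "i \<in> c ` {..<p}")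
  case True
  then obtain v where "v < p" "c v = i" by auto
  then have "{v \<in> {..<p}. c v = i} = {v}" using assms by (auto dest: inj_onD)
  then show ?thesis using True by simp
next
  case False
  then have "{v \<in> {..<p}. c v = i} = {}" by auto
  then show ?thesis using False by (simp only: card.empty if_False)
qed

lemma proper_coloring_complete_graph_onto:
  assumes "proper_coloring (complete_graph p) p c"
  shows "c ` {..<p} = {..<p}"
  using assms unfolding proper_coloring_complete_graph_iff
  by (intro card_subset_eq) (auto simp: card_image)

lemma chromatic_surplus_complete_graph:
  assumes "p > 0"
  shows "chromatic_surplus (complete_graph p) = 1"
proof (rule chromatic_surplus_eqI, unfold chromatic_number_complete_graph)
  show "\<exists>c. proper_coloring (complete_graph p) p c"
    by (auto simp: proper_coloring_complete_graph_iff intro!: exI[of _ id])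
  fix c assume c: "proper_coloring (complete_graph p) p c"
  then have "(\<lambda>i. card {v \<in> verts (complete_graph p). c v = i}) ` {..<p} = (\<lambda>i. 1) ` {..<p}"
    using color_class_complete_graph[of c p] proper_coloring_complete_graph_onto[OF c]
    by (intro image_cong) (auto simp: proper_coloring_complete_graph_iff)
  also have "\<dots> = {1}" using assms by auto
  finally show "Min ((\<lambda>i. card {v \<in> verts (complete_graph p). c v = i}) ` {..<p}) = 1" by simp
qed

text \<open>
  Every color occurs exactly once on the larger clique and at most once on the smaller one. So all
  color classes have one or two vertices, and a class of one vertex exists iff the smaller clique
  misses a color.
\<close>

lemma chromatic_surplus_complete_union:
  assumes "q \<le> p" "p > 0"
  shows "chromatic_surplus (disjoint_union (complete_graph p) (complete_graph q)) = (if q = p then 2 else 1)"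
proof (rule chromatic_surplus_eqI, unfold chromatic_number_complete_union[OF assms(1)])
  let ?H = "disjoint_union (complete_graph p) (complete_graph q)"
  show "\<exists>c. proper_coloring ?H p c"
    using assms by (intro exI[of _ "case_sum id id"])
      (auto simp: proper_coloring_disjoint_union_iff proper_coloring_complete_graph_iff o_def)
  fix c assume "proper_coloring ?H p c"
  then have l: "proper_coloring (complete_graph p) p (c \<circ> Inl)"
    and r: "proper_coloring (complete_graph q) p (c \<circ> Inr)"
    by (auto simp: proper_coloring_disjoint_union_iff)
  let ?I = "(c \<circ> Inr) ` {..<q}"
  have size: "card {v \<in> verts ?H. c v = i} = 1 + (if i \<in> ?I then 1 else 0)" if "i < p" for i
  proof -
    have "{v \<in> verts ?H. c v = i} = {v \<in> {..<p}. (c \<circ> Inl) v = i} <+> {v \<in> {..<q}. (c \<circ> Inr) v = i}"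
      by auto
    moreover have "i \<in> (c \<circ> Inl) ` {..<p}"
      using proper_coloring_complete_graph_onto[OF l] that by simp
    ultimately show ?thesis
      using l r color_class_complete_graph[of "c \<circ> Inl" p i] color_class_complete_graph[of "c \<circ> Inr" q i]
      by (simp only: proper_coloring_complete_graph_iff) (simp add: card_Plus)
  qed
  have I: "?I \<subseteq> {..<p}" "card ?I = q"
    using r card_image[of "c \<circ> Inr" "{..<q}"] unfolding proper_coloring_complete_graph_iff by simp_all
  have sizes: "(\<lambda>i. card {v \<in> verts ?H. c v = i}) ` {..<p} = (\<lambda>i. 1 + (if i \<in> ?I then 1 else 0)) ` {..<p}"
    by (intro image_cong refl size) simp
  show "Min ((\<lambda>i. card {v \<in> verts ?H. c v = i}) ` {..<p}) = (if q = p then 2 else 1)"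
  proof (cases "q = p")
    case True
    then have "?I = {..<p}" using I by (intro card_subset_eq) auto
    then have "(\<lambda>i. 1 + (if i \<in> ?I then 1 else 0)) ` {..<p} = {2 :: nat}" using assms by auto
    then show ?thesis unfolding sizes using True by simp
  next
    case False
    then have "?I \<noteq> {..<p}" using I by auto
    then obtain i where "i < p" "i \<notin> ?I" using I by auto
    then show ?thesis unfolding sizes using False by (intro Min_eqI) (auto intro!: image_eqI[of _ _ i])
  qed
qed

section \<open>The lower bound\<close>

text \<open>
  A property that passes along edges holds on a whole connected graph as soon as it holds at one
  vertex. It is applied to \<^emph>\<open>lying in a fixed block\<close> and to \<^emph>\<open>being one of two given vertices\<close>.
\<close>

lemma connected_adjacency_induct:
  assumes "graph G" "Digraph_Component.connected G" "u \<in> verts G" "P u"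
    and step: "\<And>x y. (x, y) \<in> arcs_ends G \<Longrightarrow> P x \<Longrightarrow> P y"
    and "w \<in> verts G"
  shows "P w"
proof -
  interpret graph G by fact
  have "strongly_connected G" using symmetric_connected_imp_strongly_connected sym_arcs assms by blast
  then have "u \<rightarrow>\<^sup>*\<^bsub>G\<^esub> w" using assms by (auto simp: strongly_connected_def)
  then show ?thesis using \<open>P u\<close>
    by (induct rule: reachable_induct) (auto intro: step)
qed

text \<open>
  The coloring has at most \<open>k - 1\<close> red blocks of \<^term>\<open>card (verts G) - 1\<close> consecutive numbers, with all
  edges between different blocks blue. The blocks are the fibers of integer division, so the
  coloring makes sense for every \<open>M\<close> up to the bound, as a statement about a least number requires.
\<close>

lemma block_coloring:
  assumes G: "graph G" "Digraph_Component.connected G"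
    and M: "M \<le> (card (verts G) - 1) * (k - 1)" and k: "k > 0"
  obtains c where "\<nexists>f. mono_copy c Red {..<M} G f"
    "\<nexists>A. A \<subseteq> {..<M} \<and> card A = k \<and> mono_clique c Blue A"
proof -
  interpret graph G by fact
  define b where "b = card (verts G) - 1"
  have ne: "verts G \<noteq> {}" using G(2) by (simp add: connected_conv)
  define c where "c = (\<lambda>e. if \<exists>i. \<forall>a \<in> e. a div b = i then Red else Blue)"
  have c: "c {a, a'} = Red \<longleftrightarrow> a div b = a' div b" for a a' by (auto simp: c_def)
  have "\<not> mono_copy c Red {..<M} G f" for f
  proof
    assume f: "mono_copy c Red {..<M} G f"
    obtain u where u: "u \<in> verts G" using ne by blast
    define i where "i = f u div b"
    have "f u < M" using f u by (auto simp: mono_copy_def)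
    then have "b > 0" using M unfolding b_def[symmetric] by (cases "b = 0") auto
    have block: "f w div b = i" if "w \<in> verts G" for w
      by (rule connected_adjacency_induct[OF G u _ _ that]) (use f in \<open>auto simp: i_def mono_copy_def c\<close>)
    have "i * b \<le> f w \<and> f w < i * b + b" if "w \<in> verts G" for w
      using block[OF that] div_mult_mod_eq[of "f w" b] mod_less_divisor[OF \<open>b > 0\<close>, of "f w"] by auto
    then have "f ` verts G \<subseteq> {i * b ..< i * b + b}" by auto
    then have "card (verts G) \<le> b"
      using f card_inj_on_le[of f "verts G" "{i * b ..< i * b + b}"] by (simp add: mono_copy_def)
    moreover have "card (verts G) > 0" using ne by (simp add: card_gt_0_iff)
    ultimately show False by (simp add: b_def)
  qed
  moreover have False if A: "A \<subseteq> {..<M}" "card A = k" "mono_clique c Blue A" for A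
  proof -
    have "inj_on (\<lambda>a. a div b) A"
      using A(3) by (intro inj_onI) (metis c color.distinct(1) mono_clique_def)
    moreover have "(\<lambda>a. a div b) ` A \<subseteq> {..<k - 1}"
      using A(1) M unfolding b_def[symmetric]
      by (auto intro!: less_mult_imp_div_less simp: mult.commute[of b])
    ultimately have "k \<le> k - 1" using card_inj_on_le[of "\<lambda>a. a div b" A "{..<k - 1}"] A(2) by simp
    then show False using k by simp
  qed
  ultimately show ?thesis using that by blast
qed

section \<open>Attaching two leaves\<close>

lemma degree_one_neighbor:
  assumes "graph G" "out_degree G u = 1"
  obtains u' where "(u, u') \<in> arcs_ends G" "\<And>w. (u, w) \<in> arcs_ends G \<Longrightarrow> w = u'"
proof -
  interpret graph G by fact
  obtain a where a: "out_arcs G u = {a}" using assms(2) card_1_singletonE unfolding out_degree_def by blast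
  show ?thesis
    by (rule that[of "head G a"]) (use a in \<open>auto simp: out_arcs_def arcs_ends_conv\<close>)
qed

text \<open>
  Two adjacent vertices of degree one form a component of their own, which leaves no room for a
  third vertex.
\<close>

lemma leaves_not_adjacent:
  assumes G: "graph G" "Digraph_Component.connected G" "card (verts G) \<ge> 3"
    and u: "u \<in> verts G" "out_degree G u = 1" and v: "v \<in> verts G" "out_degree G v = 1"
  shows "(u, v) \<notin> arcs_ends G"
proof
  assume uv: "(u, v) \<in> arcs_ends G"
  have vu: "(v, u) \<in> arcs_ends G" using adjacent_in_graph[OF G(1) uv] by simp
  have only_v: "w = v" if "(u, w) \<in> arcs_ends G" for w
    using degree_one_neighbor[OF G(1) u(2)] uv that by metis
  have only_u: "w = u" if "(v, w) \<in> arcs_ends G" for w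
    using degree_one_neighbor[OF G(1) v(2)] vu that by metis
  have "w \<in> {u, v}" if "w \<in> verts G" for w
  proof (rule connected_adjacency_induct[OF G(1,2) u(1) _ _ that])
    fix x y assume "(x, y) \<in> arcs_ends G" "x \<in> {u, v}"
    then show "y \<in> {u, v}" using only_v only_u by auto
  qed simp
  then have "card (verts G) \<le> card {u, v}" by (intro card_mono) auto
  also have "\<dots> \<le> 2" by (simp add: card_insert_if)
  finally show False using G(3) by simp
qed

lemma graph_induce_subgraph:
  assumes "graph G" "V \<subseteq> verts G"
  shows "graph (G \<restriction> V)"
proof -
  interpret graph G by fact
  have sub: "induced_subgraph (G \<restriction> V) G" using assms(2) by (rule induced_induce)
  have "symmetric (G \<restriction> V)" using sym_arcs sub by (rule induced_graph_imp_symmetric)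
  then show ?thesis
    using assms(2) by unfold_locales
      (auto simp: arc_to_ends_def intro: finite_subset no_multi_arcs dest: no_loops)
qed

text \<open>
  The vertices \<open>a\<close> and \<open>b\<close> outside \<open>S\<close> become the images of \<open>u\<close> and \<open>v\<close>. The only edges to be
  checked beyond those of the given copy are the ones from \<open>u\<close> to \<open>u'\<close> and from \<open>v\<close> to \<open>v'\<close>. The
  case \<open>u' = v'\<close> is included: then \<open>a\<close> and \<open>b\<close> are two neighbors of the same vertex of the copy.
\<close>

lemma mono_copy_add_two_leaves:
  assumes G: "graph G" and uv: "u \<in> verts G" "v \<in> verts G" "u \<noteq> v" "(u, v) \<notin> arcs_ends G"
    and u': "\<And>w. (u, w) \<in> arcs_ends G \<Longrightarrow> w = u'" and v': "\<And>w. (v, w) \<in> arcs_ends G \<Longrightarrow> w = v'"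
    and g: "mono_copy c x S (G \<restriction> (verts G - {u, v})) g"
    and a: "c {g u', a} = x" "a \<notin> S" "a \<in> T" and b: "c {g v', b} = x" "b \<notin> S" "b \<in> T"
    and ab: "a \<noteq> b" and "S \<subseteq> T"
  shows "mono_copy c x T G (g(u := a, v := b))"
proof -
  let ?f = "g(u := a, v := b)" and ?V = "verts G - {u, v}"
  have V: "verts G = insert u (insert v ?V)" using uv by auto
  have gS: "inj_on g ?V" "g ` ?V \<subseteq> S" using g by (auto simp: mono_copy_def)
  have inj: "inj_on ?f (verts G)"
  proof -
    have "inj_on ?f ?V" by (rule iffD2[OF inj_on_cong gS(1)]) simp
    moreover have "?f ` ?V \<subseteq> S" using gS(2) by auto
    moreover have "?f u = a" "?f v = b" using uv(3) by auto
    ultimately have "inj_on ?f (insert u (insert v ?V))"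
      using a(2) b(2) ab by (auto simp only: inj_on_insert)
    then show ?thesis using V by simp
  qed
  have img: "?f ` verts G \<subseteq> T" using gS a b \<open>S \<subseteq> T\<close> by auto
  have vu: "(v, u) \<notin> arcs_ends G" using uv(4) adjacent_in_graph(4)[OF G] by blast
  have "c {?f y, ?f z} = x" if yz: "(y, z) \<in> arcs_ends G" for y z
  proof -
    have zy: "(z, y) \<in> arcs_ends G" and "y \<noteq> z" "y \<in> verts G" "z \<in> verts G"
      using adjacent_in_graph[OF G yz] by auto
    consider "y = u" "z \<notin> {u, v}" | "y = v" "z \<notin> {u, v}" | "z = u" "y \<notin> {u, v}" | "z = v" "y \<notin> {u, v}"
      | "y \<notin> {u, v}" "z \<notin> {u, v}"
      using yz zy vu uv \<open>y \<noteq> z\<close> by auto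
    then show ?thesis
    proof cases
      case 5
      then have "(y, z) \<in> arcs_ends (G \<restriction> ?V)" using yz adjacent_in_graph[OF G yz]
        by (auto simp: arcs_ends_conv)
      then show ?thesis using g 5 by (auto simp: mono_copy_def)
    qed (use u' v' yz zy a(1) b(1) in \<open>auto simp: insert_commute\<close>)
  qed
  then have "\<forall>(y, z) \<in> arcs_ends G. c {?f y, ?f z} = x" by blast
  then show ?thesis using inj img unfolding mono_copy_def by (intro conjI)
qed

text \<open>
  The dichotomy behind the upper bound: either the blue clique grows, or there is a red edge on
  which a leaf can be hung.
\<close>

lemma blue_clique_extends_or_red_neighbor:
  assumes "mono_clique c Blue A"
  shows "mono_clique c Blue (insert x A) \<or> (\<exists>a \<in> A. c {x, a} = Red)"
proof (cases "\<exists>a \<in> A. c {x, a} = Red")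
  case False
  have "c {x, a} = Blue" if "a \<in> A" for a using False that by (cases "c {x, a}") auto
  then have "mono_clique c Blue (insert x A)"
    using assms by (auto simp: mono_clique_def insert_commute)
  then show ?thesis by blast
qed blast

section \<open>Goodness for the union of two complete graphs\<close>

theorem theorem3p1:
  fixes m l n :: nat and G :: "('a, 'b) pre_digraph"
  assumes "m > l" and "l \<ge> 2"
    and "graph G" and "card (verts G) = n" and "n \<ge> 3"
    and "good (disjoint_union (complete_graph (m - 1)) (complete_graph (m - 1))) G"
    and "\<exists>u v. u \<in> verts G \<and> v \<in> verts G \<and> u \<noteq> v \<and> out_degree G u = 1 \<and> out_degree G v = 1
           \<and> good (complete_graph m) (G \<restriction> (verts G - {u, v}))"
  shows "good (disjoint_union (complete_graph m) (complete_graph l)) G"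
proof -
  let ?H = "disjoint_union (complete_graph m) (complete_graph l)"
  let ?D = "disjoint_union (complete_graph (m - 1)) (complete_graph (m - 1))"
  define N where "N = (n - 1) * (m - 1) + 1"
  have H: "graph ?H" and D: "graph ?D" by (intro graph_disjoint_union graph_complete_graph)+
  have conn: "Digraph_Component.connected G"
    and RD: "ramsey_number G ?D = (n - 1) * (m - 2) + 2"
    using assms(1,2,4,6) chromatic_number_complete_union[of "m - 1" "m - 1"]
      chromatic_surplus_complete_union[of "m - 1" "m - 1"] by (auto simp: good_def numeral_2_eq_2)
  obtain u v where uv: "u \<in> verts G" "v \<in> verts G" "u \<noteq> v" and deg: "out_degree G u = 1" "out_degree G v = 1"
    and good': "good (complete_graph m) (G \<restriction> (verts G - {u, v}))" using assms(7) by blast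
  define G' where "G' = G \<restriction> (verts G - {u, v})"
  have card': "card (verts G') = n - 2" using uv assms(4) by (simp add: G'_def card_Diff_subset)
  have RG': "ramsey_number G' (complete_graph m) = (n - 3) * (m - 1) + 1"
    using good' assms(1) card' by (simp add: good_def chromatic_number_complete_graph
      chromatic_surplus_complete_graph G'_def[symmetric] numeral_3_eq_3)
  have G': "graph G'"
    unfolding G'_def using assms(3) by (rule graph_induce_subgraph) simp
  have nadj: "(u, v) \<notin> arcs_ends G"
    using leaves_not_adjacent[OF assms(3) conn] assms(4,5) uv deg by simp
  obtain u' where u': "(u, u') \<in> arcs_ends G" "\<And>w. (u, w) \<in> arcs_ends G \<Longrightarrow> w = u'"
    using degree_one_neighbor[OF assms(3) deg(1)] by blast
  obtain v' where v': "(v, v') \<in> arcs_ends G" "\<And>w. (v, w) \<in> arcs_ends G \<Longrightarrow> w = v'"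
    using degree_one_neighbor[OF assms(3) deg(2)] by blast
  \<comment> \<open>Both neighbors survive the deletion because the two leaves are not adjacent.\<close>
  have in': "u' \<in> verts G'" "v' \<in> verts G'"
    using adjacent_in_graph[OF assms(3) u'(1)] adjacent_in_graph[OF assms(3) v'(1)] u'(1) nadj
    unfolding G'_def by auto

  have "ramsey_number G ?H = N"
    unfolding ramsey_number_def
  proof (rule Least_equality)
    show "\<forall>c. has_copy (color_graph N c Red) G \<or> has_copy (color_graph N c Blue) ?H"
    proof (intro allI, rule ccontr)
      fix c assume "\<not> (has_copy (color_graph N c Red) G \<or> has_copy (color_graph N c Blue) ?H)"
      then have noG: "\<not> mono_copy c Red {..<N} G f" and noH: "\<not> mono_copy c Blue {..<N} ?H f'" for f f'
        unfolding has_copy_color_graph_iff[OF assms(3)] has_copy_color_graph_iff[OF H] by auto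
      \<comment> \<open>A clique of size \<open>m - 1\<close> contains one of size \<open>l\<close>, so it is enough to exclude \<open>K\<^sub>m \<union> K\<^sub>m\<^sub>-\<^sub>1\<close>.\<close>
      have no_cliques: False
        if "mono_clique c Blue A" "mono_clique c Blue B" "card A = m" "card B = m - 1" "A \<inter> B = {}"
          "A \<union> B \<subseteq> {..<N}" for A B
      proof -
        have "l \<le> card B" using that(4) assms(1) by simp
        moreover have "finite A" "finite B" using finite_subset[OF that(6)] by auto
        ultimately show False
          using mono_copy_complete_unionI[OF that(1-3) _ that(5) _ _ that(6), of l] noH by blast
      qed
      have "m - 1 = Suc (m - 2)" using assms(1,2) by simp
      then have "(n - 1) * (m - 1) = (n - 1) * (m - 2) + (n - 1)"
        by (simp only: mult_Suc_right add.commute)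
      then have "ramsey_number G ?D \<le> N" using assms(5) unfolding RD N_def by linarith
      then obtain d where d: "mono_copy c Blue {..<N} ?D d"
        using ramsey_number_mono_copy[OF assms(3) D, of "{..<N}" c] noG by auto
      define A B where "A = (d \<circ> Inl) ` {..<m - 1}" and "B = (d \<circ> Inr) ` {..<m - 1}"
      have dA: "mono_copy c Blue {..<N} (complete_graph (m - 1)) (d \<circ> Inl)"
        and dB: "mono_copy c Blue {..<N} (complete_graph (m - 1)) (d \<circ> Inr)" and AB: "A \<inter> B = {}"
        using d unfolding mono_copy_disjoint_union_iff A_def B_def by (simp_all add: image_comp)
      note A = mono_copy_complete_graphD[OF dA, folded A_def]
        and B = mono_copy_complete_graphD[OF dB, folded B_def]
      have fin: "finite A" "finite B" using A_def B_def by auto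
      define S where "S = {..<N} - (A \<union> B)"
      have "card S = N - 2 * (m - 1)"
        using A B AB fin by (simp add: S_def card_Diff_subset card_Un_disjoint)
      also have "\<dots> = (n - 3) * (m - 1) + 1"
      proof -
        have "n - 1 = (n - 3) + 2" using assms(5) by simp
        then show ?thesis unfolding N_def by (simp add: distrib_right)
      qed
      \<comment> \<open>The number of remaining vertices is exactly the Ramsey number of \<open>G - {u, v}\<close> and \<open>K\<^sub>m\<close>.\<close>
      finally have S: "card S \<ge> ramsey_number G' (complete_graph m)" "finite S"
        by (simp_all add: RG' S_def)
      from ramsey_number_mono_copy[OF G' graph_complete_graph S(2,1)]
      consider g where "mono_copy c Red S G' g" | g where "mono_copy c Blue S (complete_graph m) g"
        by metis
      then show False
      proof cases
        case 2
        show False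
          by (rule no_cliques[OF mono_copy_complete_graphD(1)[OF 2] A(1) mono_copy_complete_graphD(2)[OF 2] A(2)])
            (use mono_copy_complete_graphD(3)[OF 2] A(3) in \<open>auto simp: S_def\<close>)
      next
        case 1
        have gS: "g u' \<in> S" "g v' \<in> S" using 1 in' by (auto simp: mono_copy_def)
        \<comment> \<open>A vertex that is blue to all of one clique would extend it to a \<open>K\<^sub>m\<close> disjoint from the other.\<close>
        have red_neighbor: "\<exists>a \<in> A. c {x, a} = Red" "\<exists>a \<in> B. c {x, a} = Red" if "x \<in> S" for x
        proof -
          have x: "x < N" "x \<notin> A" "x \<notin> B" using that by (auto simp: S_def)
          have m: "Suc (m - 1) = m" using assms(1) by simp
          show "\<exists>a \<in> A. c {x, a} = Red"
            using blue_clique_extends_or_red_neighbor[OF A(1), of x] no_cliques[of "insert x A" B] A B AB fin x m by auto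
          show "\<exists>a \<in> B. c {x, a} = Red"
            using blue_clique_extends_or_red_neighbor[OF B(1), of x] no_cliques[of "insert x B" A] A B AB fin x m by auto
        qed
        obtain a where a: "a \<in> A" "c {g u', a} = Red" using red_neighbor(1)[OF gS(1)] by blast
        obtain b where b: "b \<in> B" "c {g v', b} = Red" using red_neighbor(2)[OF gS(2)] by blast
        \<comment> \<open>Taking \<open>a\<close> and \<open>b\<close> from different cliques makes them distinct.\<close>
        have "mono_copy c Red {..<N} G (g(u := a, v := b))"
          by (rule mono_copy_add_two_leaves[OF assms(3) uv nadj u'(2) v'(2) 1[unfolded G'_def] a(2) _ _ b(2)])
            (use a(1) b(1) A(3) B(3) AB in \<open>auto simp: S_def\<close>)
        then show False using noG by blast
      qed
    qed
  next
    fix M assume M: "\<forall>c. has_copy (color_graph M c Red) G \<or> has_copy (color_graph M c Blue) ?H"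
    \<comment> \<open>The first component of a blue copy of the union is already a blue \<open>K\<^sub>m\<close>, and the block coloring has none.\<close>
    show "N \<le> M"
    proof (rule ccontr)
      assume "\<not> N \<le> M"
      then have "M \<le> (card (verts G) - 1) * (m - 1)" "m > 0" using assms(1,4) by (auto simp: N_def)
      then obtain c where c: "\<nexists>f. mono_copy c Red {..<M} G f"
        "\<nexists>A. A \<subseteq> {..<M} \<and> card A = m \<and> mono_clique c Blue A"
        using block_coloring[OF assms(3) conn] by metis
      then obtain f where "mono_copy c Blue {..<M} ?H f"
        using spec[OF M, of c] unfolding has_copy_color_graph_iff[OF assms(3)] has_copy_color_graph_iff[OF H]
        by auto
      then have "mono_copy c Blue {..<M} (complete_graph m) (f \<circ> Inl)"
        by (simp add: mono_copy_disjoint_union_iff)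
      from mono_copy_complete_graphD[OF this] c(2) show False by blast
    qed
  qed
  then show ?thesis
    using conn assms(1,2,4,5) chromatic_number_complete_union[of l m] chromatic_surplus_complete_union[of l m]
    by (simp add: good_def N_def)
qed

end
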